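(* Let $n\ge 1$, let $S\subseteq \{1,2,\ldots,\lfloor n/2\rfloor\}$, and let $G=C_n(S)$ be the corresponding circulant graph. Then $G$ is chordal if and only if there exists an integer $d\geq 1$ such that $n=dm$ for some integer $m$ and $G=C_{n}(\{d,2d,\ldots,\lfloor\frac{m}{2}\rfloor d\})$.
   Context: For $S\subseteq T:=\{1,2,\ldots,\lfloor n/2\rfloor\}$, the circulant graph $C_n(S)$ is the simple graph with vertex set $\mathbb{Z}_n=\{0,\ldots,n-1\}$ and edge set $\{\{i,j\} : |j-i|_n\in S\}$, where $|k|_n=\min\{|k|,n-|k|\}$ (computed for the integer representatives $i,j\in\{0,\ldots,n-1\}$). A chord of a cycle $\mathcal{C}$ in a graph $G$ is an edge of $G$ not in $\mathcal{C}$ joining two vertices of $\mathcal{C}$; $G$ is chordal if every cycle of length at least $4$ has a chord. *)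

theory Defs
  imports Main
begin

record 'a graph =
  verts :: "'a set"
  edges :: "'a set set"

text \<open>A cycle is represented by the list of its vertices in cyclic order;
  its length is the length of the list.\<close>

definition cycle_edges :: "'a list \<Rightarrow> 'a set set" where
  "cycle_edges vs = {{vs ! i, vs ! (Suc i mod length vs)} | i. i < length vs}"

definition is_cycle :: "'a graph \<Rightarrow> 'a list \<Rightarrow> bool" where
  "is_cycle G vs \<longleftrightarrow>
     3 \<le> length vs \<and> distinct vs \<and> set vs \<subseteq> verts G \<and> cycle_edges vs \<subseteq> edges G"

definition is_chord :: "'a graph \<Rightarrow> 'a list \<Rightarrow> 'a set \<Rightarrow> bool" where
  "is_chord G vs e \<longleftrightarrow>
     e \<in> edges G \<and> e \<notin> cycle_edges vs \<and>
     (\<exists>u\<in>set vs. \<exists>v\<in>set vs. u \<noteq> v \<and> e = {u, v})"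

definition chordal :: "'a graph \<Rightarrow> bool" where
  "chordal G \<longleftrightarrow> (\<forall>vs. is_cycle G vs \<and> 4 \<le> length vs \<longrightarrow> (\<exists>e. is_chord G vs e))"

text \<open>Only used for \<open>\<bar>k\<bar> < n\<close>, where the minimum is nonnegative and \<open>nat\<close> loses nothing.\<close>

definition circ_abs :: "nat \<Rightarrow> int \<Rightarrow> nat" where
  "circ_abs n k = nat (min \<bar>k\<bar> (int n - \<bar>k\<bar>))"

text \<open>Loop-free, hence simple, whenever \<open>0 \<notin> S\<close>.\<close>

definition circulant :: "nat \<Rightarrow> nat set \<Rightarrow> nat graph" where
  "circulant n S =
     \<lparr>verts = {0..<n},
      edges = {{i, j} | i j. i \<in> {0..<n} \<and> j \<in> {0..<n} \<and> circ_abs n (int j - int i) \<in> S}\<rparr>"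

end

theory Submission
  imports Defs
begin

text \<open>
  Let \<open>A\<close> be the symmetric connection set in \<open>\<int>/n\<close> and \<open>d\<close> its least positive element.
  If \<open>k\<close> is least with \<open>k d \<notin> A \<union> {0}\<close>, let \<open>l > k\<close> be the next multiplier with \<open>l d \<in> A\<close>;
  walking from \<open>0\<close> to \<open>l d\<close> by steps alternating between \<open>r d\<close> and \<open>(k - r) d\<close>, where \<open>0 < r < k\<close>
  and \<open>r \<equiv> l\<close> modulo \<open>k\<close> if \<open>k\<close> does not divide \<open>l\<close>, gives a cycle without chords, as
  two or more consecutive steps sum to a multiplier in \<open>{k..<l}\<close>. So \<open>A \<union> {0}\<close> contains the
  subgroup generated by \<open>d\<close>, whence \<open>d\<close> divides \<open>n\<close>. If \<open>b\<close> is the least element of \<open>A\<close> outside this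
  subgroup, then \<open>b - d \<notin> A\<close>, so there is a least \<open>j > 0\<close> with \<open>b + j d \<notin> A\<close>, and
  \<open>0, d, b + j d, b\<close> is a cycle without chords. Hence \<open>A \<union> {0}\<close> is the subgroup generated by \<open>d\<close>.
\<close>

section \<open>Edges of a cycle in terms of positions\<close>

lemma doubleton_mem_cycle_edges_iff:
  assumes "distinct vs" "i < j" "j < length vs"
  shows "{vs ! i, vs ! j} \<in> cycle_edges vs \<longleftrightarrow> j = Suc i \<or> i = 0 \<and> j = length vs - 1"
proof -
  let ?N = "length vs"
  have ij: "i < ?N" using assms by simp
  have eq: "vs ! a = vs ! b \<longleftrightarrow> a = b" if "a < ?N" "b < ?N" for a b
    using that assms(1) by (simp add: nth_eq_iff_index_eq)
  have "{vs ! i, vs ! j} \<in> cycle_edges vs \<longleftrightarrow>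
      (\<exists>a<?N. {vs ! i, vs ! j} = {vs ! a, vs ! (Suc a mod ?N)})"
    unfolding cycle_edges_def by blast
  also have "\<dots> \<longleftrightarrow> (\<exists>a<?N. i = a \<and> j = Suc a mod ?N \<or> i = Suc a mod ?N \<and> j = a)"
  proof -
    have "({vs ! i, vs ! j} = {vs ! a, vs ! (Suc a mod ?N)}) \<longleftrightarrow>
        (i = a \<and> j = Suc a mod ?N \<or> i = Suc a mod ?N \<and> j = a)" if "a < ?N" for a
    proof -
      have "Suc a mod ?N < ?N" using that by (intro mod_less_divisor) linarith
      then show ?thesis using that ij assms(3) by (auto simp: doubleton_eq_iff eq)
    qed
    then show ?thesis by blast
  qed
  also have "\<dots> \<longleftrightarrow> j = Suc i mod ?N \<or> i = Suc j mod ?N" using ij assms by blast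
  also have "\<dots> \<longleftrightarrow> j = Suc i \<or> i = 0 \<and> j = ?N - 1"
  proof -
    have "Suc i mod ?N = Suc i" using assms by simp
    moreover have "Suc j mod ?N = (if j = ?N - 1 then 0 else Suc j)"
      using assms by (auto simp: mod_Suc)
    ultimately show ?thesis using assms by auto
  qed
  finally show ?thesis .
qed

section \<open>Circulant adjacency as a periodic predicate on the integers\<close>

text \<open>The reduction modulo \<open>n\<close> pulls the connection set back to all integers, so
  that differences of vertices can be computed there.\<close>

definition conn :: "nat \<Rightarrow> nat set \<Rightarrow> int \<Rightarrow> bool" where
  "conn n S x \<longleftrightarrow> circ_abs n (x mod int n) \<in> S"

lemma conn_cong: "x mod int n = y mod int n \<Longrightarrow> conn n S x \<longleftrightarrow> conn n S y"
  by (simp add: conn_def)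

lemma circ_abs_uminus: "circ_abs n (- x) = circ_abs n x"
  by (simp add: circ_abs_def)

text \<open>For \<open>x < 0\<close> the residue is \<open>x + int n\<close>, which only swaps the
  two arguments of \<open>min\<close>.\<close>

lemma circ_abs_mod:
  assumes "\<bar>x\<bar> < int n"
  shows "circ_abs n (x mod int n) = circ_abs n x"
proof (cases "x \<ge> 0")
  case True
  then show ?thesis using assms by simp
next
  case False
  then have "x mod int n = x + int n"
    using assms by (intro int_mod_pos_eq[where q = "-1"]) auto
  then show ?thesis using False assms by (auto simp: circ_abs_def)
qed

lemma conn_small: "\<bar>x\<bar> < int n \<Longrightarrow> conn n S x \<longleftrightarrow> circ_abs n x \<in> S"
  by (simp add: conn_def circ_abs_mod)

lemma conn_uminus:
  assumes "n > 0"
  shows "conn n S (- x) \<longleftrightarrow> conn n S x"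
proof -
  have "conn n S (- x) \<longleftrightarrow> conn n S (- (x mod int n))"
    by (intro conn_cong) (simp add: mod_minus_eq)
  also have "\<dots> \<longleftrightarrow> conn n S x"
    using assms conn_small[of "- (x mod int n)" n S] by (simp add: conn_def circ_abs_uminus)
  finally show ?thesis .
qed

lemma not_conn_zero: "0 \<notin> S \<Longrightarrow> \<not> conn n S 0"
  by (simp add: conn_def circ_abs_def)

lemma conn_nat:
  assumes "S \<subseteq> {1..n div 2}" "x \<le> n div 2" "n > 0"
  shows "conn n S (int x) \<longleftrightarrow> x \<in> S"
proof -
  have "circ_abs n (int x) = x" using assms by (auto simp: circ_abs_def)
  moreover have "\<bar>int x\<bar> < int n" using assms by auto
  ultimately show ?thesis by (simp add: conn_small)
qed

lemma edge_circulant_iff: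
  "{i, j} \<in> edges (circulant n S) \<longleftrightarrow> i < n \<and> j < n \<and> conn n S (int j - int i)"
proof -
  have "{i, j} \<in> edges (circulant n S) \<longleftrightarrow>
      i < n \<and> j < n \<and> (circ_abs n (int j - int i) \<in> S \<or> circ_abs n (int i - int j) \<in> S)"
    by (auto simp: circulant_def doubleton_eq_iff)
  also have "circ_abs n (int i - int j) = circ_abs n (int j - int i)"
    using circ_abs_uminus[of n "int i - int j"] by simp
  finally show ?thesis by (auto simp: conn_small)
qed

lemma verts_circulant: "verts (circulant n S) = {0..<n}"
  by (simp add: circulant_def)

text \<open>Turns chordality into a statement about integer sequences: the residues of
  \<open>v\<close> form a cycle, and a chord joins two positions that are neither consecutive nor
  the two ends.\<close>

lemma chordal_circulant_chord:
  fixes v :: "nat \<Rightarrow> int"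
  assumes chordal: "chordal (circulant n S)" and n: "n > 0" and N: "4 \<le> N"
    and dist: "\<And>i j. i < j \<Longrightarrow> j < N \<Longrightarrow> \<not> int n dvd v j - v i"
    and step: "\<And>i. Suc i < N \<Longrightarrow> conn n S (v (Suc i) - v i)"
    and close: "conn n S (v (N - 1) - v 0)"
  obtains i j where "i + 2 \<le> j" "j < N" "\<not> (i = 0 \<and> j = N - 1)" "conn n S (v j - v i)"
proof -
  define w where "w i = nat (v i mod int n)" for i
  define vs where "vs = map w [0..<N]"
  have len: "length vs = N" by (simp add: vs_def)
  have nth: "vs ! i = w i" if "i < N" for i using that by (simp add: vs_def)
  have w: "int (w i) = v i mod int n" for i using n by (simp add: w_def)
  have wn: "w i < n" for i using n by (simp add: w_def nat_less_iff)
  have conn_w: "conn n S (int (w j) - int (w i)) \<longleftrightarrow> conn n S (v j - v i)" for i j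
    unfolding w by (intro conn_cong) (simp add: mod_diff_eq)
  have edge: "{w i, w j} \<in> edges (circulant n S) \<longleftrightarrow> conn n S (v j - v i)" for i j
    by (simp add: edge_circulant_iff wn conn_w)
  have w_neq: "w i \<noteq> w j" if "i < j" "j < N" for i j
  proof
    assume "w i = w j"
    then have "v j mod int n = v i mod int n" using w by metis
    then show False using dist[OF that] by (simp add: mod_eq_dvd_iff)
  qed
  have distinct: "distinct vs"
    unfolding distinct_conv_nth len
  proof (intro allI impI)
    fix i j assume "i < N" "j < N" "i \<noteq> j"
    then show "vs ! i \<noteq> vs ! j"
      using w_neq[of i j] w_neq[of j i] by (cases "i < j") (auto simp: nth)
  qed
  have "cycle_edges vs \<subseteq> edges (circulant n S)"
  proof
    fix e assume "e \<in> cycle_edges vs"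
    then obtain i where i: "i < N" "e = {vs ! i, vs ! (Suc i mod N)}"
      by (auto simp: cycle_edges_def len)
    show "e \<in> edges (circulant n S)"
    proof (cases "Suc i < N")
      case True
      then show ?thesis using i step by (simp add: nth edge)
    next
      case False
      then have "i = N - 1" "Suc i = N" using i by auto
      then have "e = {w 0, w (N - 1)}" using i N by (auto simp: nth)
      then show ?thesis using close by (simp add: edge)
    qed
  qed
  then have "is_cycle (circulant n S) vs"
    using N distinct wn by (auto simp: is_cycle_def len verts_circulant vs_def)
  then obtain e where e: "is_chord (circulant n S) vs e"
    using chordal N len unfolding chordal_def by auto
  then obtain x y where xy: "x \<in> set vs" "y \<in> set vs" "x \<noteq> y" "e = {x, y}"
    by (auto simp: is_chord_def)
  obtain a b where ab: "a < N" "x = w a" "b < N" "y = w b"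
    using xy by (auto simp: vs_def)
  \<comment> \<open>A chord is unordered; sorting its positions allows
    \<open>doubleton_mem_cycle_edges_iff\<close> to apply.\<close>
  define i j where "i = min a b" and "j = max a b"
  have "a \<noteq> b" using ab xy by auto
  then have ij: "i < j" "j < N" using ab by (auto simp: i_def j_def)
  have eij: "e = {w i, w j}" using ab xy by (auto simp: i_def j_def min_def max_def)
  have "e \<notin> cycle_edges vs" using e by (simp add: is_chord_def)
  then have nadj: "j \<noteq> Suc i" "\<not> (i = 0 \<and> j = N - 1)"
    using doubleton_mem_cycle_edges_iff[OF distinct, of i j] ij by (auto simp: len eij nth)
  have "conn n S (v j - v i)" using e edge by (simp add: is_chord_def eij)
  then show thesis using that[of i j] ij nadj by simp
qed

section \<open>Chordal connection sets modulo \<open>n\<close>\<close>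

text \<open>The assumption \<open>chord\<close> is all that remains of the graph; what follows is
  arithmetic modulo \<open>n\<close>.\<close>

locale chordal_connection =
  fixes n :: int and A :: "int \<Rightarrow> bool"
  assumes n_pos: "n > 0"
    and A_cong: "x mod n = y mod n \<Longrightarrow> A x \<longleftrightarrow> A y"
    and A_uminus: "A (- x) \<longleftrightarrow> A x"
    and not_A_0: "\<not> A 0"
    and chord: "4 \<le> N \<Longrightarrow> (\<And>i j. i < j \<Longrightarrow> j < N \<Longrightarrow> \<not> n dvd v j - v i) \<Longrightarrow>
      (\<And>i. Suc i < N \<Longrightarrow> A (v (Suc i) - v i)) \<Longrightarrow> A (v (N - 1) - v 0) \<Longrightarrow>
      \<exists>i j. i + 2 \<le> j \<and> j < N \<and> \<not> (i = 0 \<and> j = N - 1) \<and> A (v j - v i)"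
begin

lemma A_not_dvd: "A x \<Longrightarrow> \<not> n dvd x"
  using A_cong[of x 0] not_A_0 by auto

text \<open>The case \<open>N = 4\<close>, where only the two diagonals can be chords. The sides are
  nonzero modulo \<open>n\<close> because they satisfy \<open>A\<close>.\<close>

lemma chord_square:
  assumes "A (b - a)" "A (c - b)" "A (d - c)" "A (d - a)"
    and "\<not> n dvd c - a" "\<not> n dvd d - b"
  shows "A (c - a) \<or> A (d - b)"
proof -
  define v where "v = (!) [a, b, c, d]"
  have less4: "j < 4 \<longleftrightarrow> j = 0 \<or> j = 1 \<or> j = 2 \<or> j = 3" for j :: nat by auto
  have "\<exists>i j. i + 2 \<le> j \<and> j < (4::nat) \<and> \<not> (i = 0 \<and> j = 4 - 1) \<and> A (v j - v i)"
  proof (rule chord)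
    show "\<not> n dvd v j - v i" if "i < j" "j < 4" for i j
      using that assms A_not_dvd
      by (auto simp: less4 v_def less_Suc_eq numeral_2_eq_2 numeral_3_eq_3)
    show "A (v (Suc i) - v i)" if "Suc i < 4" for i
    proof -
      have "i = 0 \<or> i = 1 \<or> i = 2" using that by auto
      then show ?thesis using assms by (auto simp: v_def)
    qed
  qed (use assms in \<open>auto simp: v_def\<close>)
  then show ?thesis
    by (auto simp: less4 v_def)
qed

text \<open>This is the alternating walk, for any \<open>a\<close>. That \<open>gap\<close> also
  excludes divisibility by \<open>n\<close> keeps the vertices of the walk distinct.\<close>

lemma no_gap_in_multiples:
  fixes a :: int and k l :: nat
  assumes A1: "\<And>e. 0 < e \<Longrightarrow> e < k \<Longrightarrow> A (int e * a)"
    and gap: "\<And>e. k \<le> e \<Longrightarrow> e < l \<Longrightarrow> \<not> A (int e * a) \<and> \<not> n dvd int e * a"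
    and Al: "A (int l * a)" and kl: "1 < k" "k < l"
  shows False
proof -
  \<comment> \<open>The walk must end exactly at \<open>l\<close>. If \<open>k\<close> divides
    \<open>l\<close>, it has an even number of steps and any \<open>r\<close> strictly between
    \<open>0\<close> and \<open>k\<close> would serve; otherwise it ends with one extra step
    \<open>l mod k\<close>.\<close>
  define r where "r = (if l mod k = 0 then 1 else l mod k)"
  define t where "t = 2 * (l div k) + (if l mod k = 0 then 0 else 1)"
  \<comment> \<open>The multiplier reached after \<open>i\<close> steps: each pair of steps adds
    \<open>k\<close>.\<close>
  define u where "u i = (i div 2) * k + (if odd i then r else 0)" for i
  have r: "0 < r" "r < k" using kl by (auto simp: r_def)
  have l: "k * (l div k) + l mod k = l" by simp
  have q1: "1 \<le> l div k" using kl by (simp add: div_greater_zero_iff Suc_le_eq)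
  \<comment> \<open>The cycle has \<open>t + 1\<close> vertices and needs four. When
    \<open>k\<close> divides \<open>l\<close>, \<open>q1\<close> alone would give only
    \<open>2 \<le> t\<close>.\<close>
  have q2: "2 \<le> l div k" if "l mod k = 0"
    using l that kl q1 by (cases "l div k = 1") auto
  have t: "3 \<le> t" using q1 q2 by (auto simp: t_def)
  have u0: "u 0 = 0" by (simp add: u_def)
  have ut: "u t = l"
  proof (cases "l mod k = 0")
    case True
    then show ?thesis using l by (simp add: u_def t_def r_def mult.commute)
  next
    case False
    then show ?thesis using l by (simp add: u_def t_def r_def mult.commute)
  qed
  have u_step: "u (Suc i) = u i + (if odd i then k - r else r)" for i
    using r by (auto simp: u_def elim!: oddE)
  have u_mono: "strict_mono u"
    using r by (auto simp: strict_mono_Suc_iff u_step)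
  have u_two: "u (i + 2) = u i + k" for i by (simp add: u_def)
  have diff: "int (u j) * a - int (u i) * a = int (u j - u i) * a" if "i \<le> j" for i j
    using that u_mono by (simp add: strict_mono_less_eq of_nat_diff left_diff_distrib)
  \<comment> \<open>Two or more steps add at least \<open>k\<close>, and leaving out a step gives
    less than \<open>l\<close>, so the difference falls into the gap.\<close>
  have long: "\<not> A (int (u j - u i) * a)" "\<not> n dvd int (u j - u i) * a"
    if ij: "i + 2 \<le> j" "j \<le> t" "\<not> (i = 0 \<and> j = t)" for i j
  proof -
    have "u (i + 2) \<le> u j" using ij u_mono by (simp add: strict_mono_less_eq)
    then have "k \<le> u j - u i" unfolding u_two by simp
    moreover have "u j - u i < l"
    proof (cases "i = 0")
      case True
      then have "u j < u t" using ij u_mono by (simp add: strict_mono_less)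
      then show ?thesis using ut by simp
    next
      case False
      then have "0 < u i" using u_mono u0 by (metis strict_mono_less neq0_conv)
      moreover have "u j \<le> u t" using ij u_mono by (simp add: strict_mono_less_eq)
      ultimately show ?thesis using ut kl by simp
    qed
    ultimately show "\<not> A (int (u j - u i) * a)" "\<not> n dvd int (u j - u i) * a"
      using gap by auto
  qed
  have short: "A (int (u (Suc i) - u i) * a)" for i
    using r by (intro A1) (auto simp: u_step)
  have "\<exists>i j. i + 2 \<le> j \<and> j < Suc t \<and> \<not> (i = 0 \<and> j = Suc t - 1) \<and>
      A (int (u j) * a - int (u i) * a)"
  proof (rule chord)
    show "4 \<le> Suc t" using t by simp
    show "\<not> n dvd int (u j) * a - int (u i) * a" if ij: "i < j" "j < Suc t" for i j
    proof -
      consider "j = Suc i" | "i = 0 \<and> j = t" | "i + 2 \<le> j" "\<not> (i = 0 \<and> j = t)"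
        using ij by linarith
      then show ?thesis
      proof cases
        case 1
        then show ?thesis using short[of i] A_not_dvd by (simp add: diff)
      next
        case 2
        then show ?thesis using Al A_not_dvd by (simp add: u0 ut)
      next
        case 3
        then show ?thesis using long[of i j] ij by (simp add: diff)
      qed
    qed
    show "A (int (u (Suc i)) * a - int (u i) * a)" for i
      using short[of i] by (simp add: diff)
    show "A (int (u (Suc t - 1)) * a - int (u 0) * a)" using Al by (simp add: u0 ut)
  qed
  then obtain i j where "i + 2 \<le> j" "j \<le> t" "\<not> (i = 0 \<and> j = t)"
    "A (int (u j) * a - int (u i) * a)" by (auto simp: less_Suc_eq_le)
  then show False using long(1)[of i j] by (simp add: diff)
qed

text \<open>The first positive multiplier \<open>k\<close> that leaves \<open>A\<close> must make
  \<open>k * a\<close> zero modulo \<open>n\<close>, as otherwise the multiples would have a gap.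
  Then \<open>e\<close> can be reduced modulo \<open>k\<close>.\<close>

lemma A_multiple:
  assumes "A a"
  shows "A (e * a) \<or> n dvd e * a"
proof -
  define P where "P k \<longleftrightarrow> 0 < k \<and> \<not> A (int k * a)" for k :: nat
  have n0: "0 < nat n" "int (nat n) = n" using n_pos by auto
  have "P (nat n)" using A_not_dvd[of "n * a"] n0 by (auto simp: P_def)
  define k where "k = (LEAST k. P k)"
  have "P k" unfolding k_def using \<open>P (nat n)\<close> by (rule LeastI)
  then have k: "0 < k" "\<not> A (int k * a)" by (auto simp: P_def)
  have below: "A (int e * a)" if "0 < e" "e < k" for e
    using that not_less_Least[of e P] by (auto simp: k_def P_def)
  have k1: "1 < k" using k assms by (cases "k = 1") auto
  have ka: "n dvd int k * a"
  proof (rule ccontr)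
    assume nd: "\<not> n dvd int k * a"
    define Q where "Q l \<longleftrightarrow> k < l \<and> (A (int l * a) \<or> n dvd int l * a)" for l
    define l where "l = (LEAST l. Q l)"
    \<comment> \<open>The multiplier \<open>k * nat n\<close> shows that \<open>Q\<close> is
      satisfiable; it exceeds \<open>k\<close> only because \<open>n\<close> is not
      \<open>1\<close>.\<close>
    have "n \<noteq> 1" using nd by auto
    then have "k < k * nat n" using k n_pos by simp
    then have "Q (k * nat n)" using n0 by (simp add: Q_def)
    then have "Q l" unfolding l_def by (rule LeastI)
    have gap: "\<not> A (int e * a) \<and> \<not> n dvd int e * a" if "k \<le> e" "e < l" for e
      using that not_less_Least[of e Q] k nd by (cases "e = k") (auto simp: l_def Q_def)
    \<comment> \<open>If \<open>l * a\<close> vanished modulo \<open>n\<close>, then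
      \<open>(l - 1) * a\<close> would be congruent to \<open>- a\<close> and so satisfy
      \<open>A\<close>, although \<open>l - 1\<close> still lies in the gap.\<close>
    have "\<not> n dvd int l * a"
    proof
      assume *: "n dvd int l * a"
      have "k \<le> l - 1" "l - 1 < l" using \<open>Q l\<close> by (auto simp: Q_def)
      then have "\<not> A (int (l - 1) * a)" using gap by blast
      moreover have "int (l - 1) * a = int l * a - a"
        using \<open>Q l\<close> by (simp add: Q_def of_nat_diff left_diff_distrib)
      moreover have "(int l * a - a) mod n = (- a) mod n"
        using * by (simp add: mod_eq_dvd_iff)
      ultimately show False using A_cong[of "int l * a - a" "- a"] A_uminus[of a] assms by simp
    qed
    then have "A (int l * a)" "k < l" using \<open>Q l\<close> by (auto simp: Q_def)
    then show False using no_gap_in_multiples[OF below gap] k1 by blast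
  qed
  define f where "f = nat (e mod int k)"
  have f: "int f = e mod int k" "f < k" using k by (auto simp: f_def nat_less_iff)
  have "e * a - int f * a = (e div int k) * (int k * a)"
    unfolding f(1) by (simp add: minus_mod_eq_div_mult[symmetric] left_diff_distrib[symmetric] flip: mult.assoc)
  then have "n dvd e * a - int f * a" using ka by simp
  then have "(e * a) mod n = (int f * a) mod n" by (simp add: mod_eq_dvd_iff)
  then show ?thesis using below[of f] f A_cong[of "e * a" "int f * a"]
    by (cases "f = 0") (auto simp: dvd_eq_mod_eq_0)
qed

theorem A_iff_multiple: "\<exists>d>0. d dvd n \<and> (\<forall>x. A x \<longleftrightarrow> d dvd x \<and> \<not> n dvd x)"
proof (cases "\<exists>x. A x")
  case False
  \<comment> \<open>The empty connection set is the trivial subgroup without zero.\<close>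
  then show ?thesis using n_pos by (intro exI[of _ n]) auto
next
  case True
  then obtain x where x: "A x" by blast
  have "A (x mod n)" using A_cong[of "x mod n" x] x by simp
  moreover have "0 < x mod n"
    using A_not_dvd[OF x] n_pos by (simp add: dvd_eq_mod_eq_0 order_less_le)
  ultimately have ex: "\<exists>e. 0 < e \<and> A (int e)" by (intro exI[of _ "nat (x mod n)"]) auto
  define d0 where "d0 = (LEAST e. 0 < e \<and> A (int e))"
  define d where "d = int d0"
  have d: "0 < d" "A d" using LeastI_ex[OF ex] by (auto simp: d_def d0_def)
  have d_min: "\<not> A y" if "0 < y" "y < d" for y
    using that not_less_Least[of "nat y" "\<lambda>e. 0 < e \<and> A (int e)"] by (auto simp: d_def d0_def)
  \<comment> \<open>Otherwise \<open>n mod d\<close> is congruent to a multiple of \<open>d\<close>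
    and, as \<open>d \<le> n\<close>, nonzero modulo \<open>n\<close>. So it satisfies
    \<open>A\<close>, against the minimality of \<open>d\<close>.\<close>
  have "d dvd n"
  proof (rule ccontr)
    assume "\<not> d dvd n"
    then have pos: "0 < n mod d" using d by (simp add: dvd_eq_mod_eq_0 order_less_le)
    have lt: "n mod d < d" using d by simp
    have "d \<le> n"
    proof (rule ccontr)
      assume "\<not> d \<le> n"
      then have "x mod n < d" using pos_mod_bound[OF n_pos, of x] by linarith
      then show False using d_min \<open>A (x mod n)\<close> \<open>0 < x mod n\<close> by blast
    qed
    then have "\<not> n dvd n mod d" using pos lt zdvd_not_zless by force
    moreover have eq: "(n mod d) mod n = (- (n div d) * d) mod n"
      by (simp add: mod_eq_dvd_iff)
    ultimately have "A (n mod d)"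
      using A_multiple[OF d(2), of "- (n div d)"] A_cong[OF eq] by (metis dvd_eq_mod_eq_0)
    then show False using d_min pos lt by blast
  qed
  have "d dvd y" if "A y" for y
  proof (rule ccontr)
    assume "\<not> d dvd y"
    define b where "b = int (LEAST e. A (int e) \<and> \<not> d dvd int e)"
    have "\<exists>e. A (int e) \<and> \<not> d dvd int e"
    proof (intro exI conjI)
      have nn: "int (nat (y mod n)) = y mod n" using n_pos by simp
      show "A (int (nat (y mod n)))" unfolding nn using A_cong[of "y mod n" y] that by simp
      show "\<not> d dvd int (nat (y mod n))"
        unfolding nn using \<open>\<not> d dvd y\<close> \<open>d dvd n\<close> by (simp add: dvd_mod_iff)
    qed
    from LeastI_ex[OF this] have b: "A b" "\<not> d dvd b" by (auto simp: b_def)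
    have b_min: "\<not> A z" if "0 \<le> z" "z < b" "\<not> d dvd z" for z
      using that not_less_Least[of "nat z" "\<lambda>e. A (int e) \<and> \<not> d dvd int e"]
      by (auto simp: b_def)
    have "0 \<le> b" by (simp add: b_def)
    moreover have "b \<noteq> 0" "b \<noteq> d" using b by auto
    ultimately have "d < b" using d_min[of b] b by linarith
    then have bd: "\<not> A (b - d)" using b_min[of "b - d"] b d by (simp add: dvd_diff_left_iff)
    define m where "m = nat (n div d)"
    have m: "n = int m * d" "0 < m"
      using \<open>d dvd n\<close> d n_pos by (auto simp: m_def pos_imp_zdiv_pos_iff zdvd_imp_le pos_imp_zdiv_nonneg_iff)
    define j where "j = (LEAST j. \<not> A (b + int j * d))"
    \<comment> \<open>Modulo \<open>n\<close>, the multiplier \<open>m - 1\<close> leads to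
      \<open>b - d\<close>. Hence \<open>j\<close> exists and is less than \<open>m\<close>, which
      keeps \<open>j * d\<close> nonzero modulo \<open>n\<close>.\<close>
    have last: "\<not> A (b + int (m - 1) * d)"
    proof -
      have eq: "b + int (m - 1) * d = b - d + n"
        using m by (simp add: of_nat_diff left_diff_distrib)
      show ?thesis unfolding eq using bd A_cong[of "b - d + n" "b - d"] by simp
    qed
    have j: "\<not> A (b + int j * d)" unfolding j_def using last by (rule LeastI)
    have "j \<le> m - 1" unfolding j_def using last by (rule Least_le)
    have "0 < j" using j b by (cases "j = 0") auto
    have before: "A (b + int (j - 1) * d)"
      using \<open>0 < j\<close> not_less_Least[of "j - 1" "\<lambda>j. \<not> A (b + int j * d)"] by (auto simp: j_def)
    have "\<not> n dvd int j * d"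
    proof
      assume "n dvd int j * d"
      then have "n \<le> int j * d" using \<open>0 < j\<close> d by (intro zdvd_imp_le) auto
      then show False using m \<open>j \<le> m - 1\<close> d by auto
    qed
    then have Aj: "A (int j * d)" using A_multiple[OF d(2)] by blast
    have nd: "\<not> n dvd z" if "\<not> d dvd z" for z
      using that \<open>d dvd n\<close> dvd_trans by blast
    \<comment> \<open>The sides \<open>d\<close>, \<open>b + (j - 1) * d\<close>,
      \<open>- j * d\<close> and \<open>b\<close> satisfy \<open>A\<close>; by the choice of
      \<open>j\<close> and \<open>b\<close> neither diagonal does.\<close>
    have "A (b + int j * d - 0) \<or> A (b - d)"
    proof (rule chord_square)
      show "A (d - 0)" using d by simp
      show "A (b + int j * d - d)"
        using before \<open>0 < j\<close> by (simp add: of_nat_diff algebra_simps)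
      show "A (b - (b + int j * d))" using Aj A_uminus[of "int j * d"] by simp
      show "A (b - 0)" using b by simp
      show "\<not> n dvd b + int j * d - 0" "\<not> n dvd b - d"
        using b by (auto intro!: nd simp: dvd_diff_left_iff dvd_add_left_iff)
    qed
    then show False using j bd by simp
  qed
  moreover have "A y" if "d dvd y" "\<not> n dvd y" for y
    using that A_multiple[OF d(2), of "y div d"] by simp
  ultimately show ?thesis using d \<open>d dvd n\<close> A_not_dvd by blast
qed

end

section \<open>Connection sets of chordal circulant graphs\<close>

lemma chordal_imp_conn_iff:
  assumes "chordal (circulant n S)" "n \<ge> 1" "0 \<notin> S"
  shows "\<exists>d>0. d dvd int n \<and> (\<forall>x. conn n S x \<longleftrightarrow> d dvd x \<and> \<not> int n dvd x)"
proof -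
  interpret chordal_connection "int n" "conn n S"
  proof
    fix N :: nat and v :: "nat \<Rightarrow> int"
    assume "4 \<le> N" "\<And>i j. i < j \<Longrightarrow> j < N \<Longrightarrow> \<not> int n dvd v j - v i"
      "\<And>i. Suc i < N \<Longrightarrow> conn n S (v (Suc i) - v i)" "conn n S (v (N - 1) - v 0)"
    with assms show "\<exists>i j. i + 2 \<le> j \<and> j < N \<and> \<not> (i = 0 \<and> j = N - 1) \<and> conn n S (v j - v i)"
      by (elim chordal_circulant_chord[where N = N and v = v]) auto
  next
    show "conn n S x \<longleftrightarrow> conn n S y" if "x mod int n = y mod int n" for x y
      using that by (rule conn_cong)
  qed (use assms in \<open>simp_all add: conn_uminus not_conn_zero\<close>)
  show ?thesis by (rule A_iff_multiple)
qed

section \<open>Circulant graphs of multiples of \<open>d\<close>, and the equivalence\<close>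

text \<open>Both bounds amount to \<open>2 * k \<le> m\<close>. The right-hand form can be compared
  with \<open>S\<close> element by element.\<close>

lemma multiples_upto_half:
  fixes d m :: nat
  assumes "d \<ge> 1"
  shows "{k * d | k. k \<in> {1..m div 2}} = {x \<in> {1..d * m div 2}. d dvd x}"
proof -
  have *: "k \<le> m div 2 \<longleftrightarrow> k * d \<le> d * m div 2" for k
    using assms by (simp add: less_eq_div_iff_mult_less_eq mult.commute mult.left_commute)
  show ?thesis using assms by (auto simp: * elim!: dvdE) (auto simp: * mult.commute)
qed

text \<open>For a residue \<open>y\<close>, \<open>min y (n - y)\<close> never exceeds
  \<open>n div 2\<close>, and \<open>d\<close> divides \<open>y\<close> iff it divides
  \<open>n - y\<close>. So the connection set is the subgroup generated by \<open>d\<close> without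
  zero.\<close>

lemma conn_multiples:
  fixes d m :: nat and x :: int
  assumes "d \<ge> 1" and "m \<ge> 1"
  shows "conn (d * m) {k * d | k. k \<in> {1..m div 2}} x \<longleftrightarrow> int d dvd x \<and> \<not> int (d * m) dvd x"
proof -
  define n where "n = d * m"
  define y where "y = nat (x mod int n)"
  have n: "0 < n" "d dvd n" using assms by (auto simp: n_def)
  have y: "int y = x mod int n" "y < n" using n by (auto simp: y_def nat_less_iff)
  have "circ_abs n (int y) = min y (n - y)"
    using y by (auto simp: circ_abs_def min_def nat_diff_distrib)
  then have "conn n {k * d | k. k \<in> {1..m div 2}} x \<longleftrightarrow>
      min y (n - y) \<in> {z \<in> {1..n div 2}. d dvd z}"
    unfolding multiples_upto_half[OF assms(1)] conn_def y(1)[symmetric] n_def[symmetric] by simp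
  also have "\<dots> \<longleftrightarrow> d dvd y \<and> y \<noteq> 0"
  proof -
    have "d dvd n - y \<longleftrightarrow> d dvd y"
      using n y by (metis dvd_diff_nat diff_diff_cancel less_imp_le)
    then show ?thesis using y by (auto simp: min_def)
  qed
  also have "\<dots> \<longleftrightarrow> int d dvd int y \<and> int y \<noteq> 0" by simp
  also have "\<dots> \<longleftrightarrow> int d dvd x \<and> \<not> int n dvd x"
    unfolding y(1) using n by (simp add: dvd_mod_iff dvd_eq_mod_eq_0[of "int n"])
  finally show ?thesis by (simp add: n_def)
qed

text \<open>Distinct vertices are adjacent iff they are congruent modulo \<open>d\<close>, so the
  graph is a disjoint union of cliques and positions \<open>0\<close> and \<open>2\<close> of a
  cycle are adjacent.\<close>

lemma chordal_circulant_multiples: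
  fixes d m :: nat
  assumes "d \<ge> 1" and "m \<ge> 1"
  shows "chordal (circulant (d * m) {k * d | k. k \<in> {1..m div 2}})" (is "chordal ?G")
  unfolding chordal_def
proof (intro allI impI)
  fix vs assume "is_cycle ?G vs \<and> 4 \<le> length vs"
  then have len: "4 \<le> length vs" and dist: "distinct vs"
    and sub: "cycle_edges vs \<subseteq> edges ?G" and vert: "set vs \<subseteq> {0..<d * m}"
    by (auto simp: is_cycle_def verts_circulant)
  have in_edges: "{vs ! i, vs ! Suc i} \<in> edges ?G" if "Suc i < length vs" for i
    using doubleton_mem_cycle_edges_iff[OF dist, of i "Suc i"] sub that by auto
  have "{vs ! 0, vs ! 1} \<in> edges ?G" "{vs ! 1, vs ! 2} \<in> edges ?G"
    using in_edges[of 0] in_edges[of 1] len by (auto simp: numeral_2_eq_2)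
  then have "int d dvd int (vs ! 1) - int (vs ! 0)" "int d dvd int (vs ! 2) - int (vs ! 1)"
    unfolding edge_circulant_iff conn_multiples[OF assms] by auto
  then have "int d dvd (int (vs ! 2) - int (vs ! 1)) + (int (vs ! 1) - int (vs ! 0))"
    by (intro dvd_add)
  then have dv: "int d dvd int (vs ! 2) - int (vs ! 0)" by simp
  have mem: "vs ! 0 \<in> set vs" "vs ! 2 \<in> set vs" using len by (auto intro!: nth_mem)
  then have lt: "vs ! 0 < d * m" "vs ! 2 < d * m" using vert by auto
  have "0 < length vs" "2 < length vs" using len by auto
  then have neq: "vs ! 0 \<noteq> vs ! 2" using dist by (simp add: nth_eq_iff_index_eq)
  have "\<not> int (d * m) dvd int (vs ! 2) - int (vs ! 0)"
  proof
    assume "int (d * m) dvd int (vs ! 2) - int (vs ! 0)"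
    then have "int (vs ! 2) mod int (d * m) = int (vs ! 0) mod int (d * m)"
      by (simp only: mod_eq_dvd_iff)
    then show False using lt neq by (simp only: flip: of_nat_mod) simp
  qed
  then have "{vs ! 0, vs ! 2} \<in> edges ?G"
    unfolding edge_circulant_iff conn_multiples[OF assms] using dv lt by simp
  \<comment> \<open>With at least four vertices, position \<open>2\<close> is not the last
    one.\<close>
  moreover have "{vs ! 0, vs ! 2} \<notin> cycle_edges vs"
    using doubleton_mem_cycle_edges_iff[OF dist, of 0 2] len by auto
  ultimately show "\<exists>e. is_chord ?G vs e" using mem neq by (auto simp: is_chord_def)
qed

theorem theorem2p1:
  fixes n :: nat and S :: "nat set"
  assumes "n \<ge> 1" and "S \<subseteq> {1..n div 2}"
  shows "chordal (circulant n S) \<longleftrightarrow>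
    (\<exists>d\<ge>1. \<exists>m. n = d * m \<and> circulant n S = circulant n {k * d | k. k \<in> {1..m div 2}})"
proof
  assume "chordal (circulant n S)"
  then obtain D where D: "D > 0" "D dvd int n" "\<And>x. conn n S x \<longleftrightarrow> D dvd x \<and> \<not> int n dvd x"
    using chordal_imp_conn_iff[of n S] assms by force
  define d where "d = nat D"
  have d: "D = int d" "d \<ge> 1" using D by (auto simp: d_def)
  then have "d dvd n" using D by simp
  then obtain m where m: "n = d * m" by blast
  \<comment> \<open>On \<open>{1..n div 2}\<close>, \<open>conn\<close> recovers membership in
    \<open>S\<close>, and no number there is divisible by \<open>n\<close>.\<close>
  have "x \<in> S \<longleftrightarrow> x \<in> {1..n div 2} \<and> d dvd x" for x
  proof (cases "x \<in> {1..n div 2}")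
    case True
    then have "\<not> n dvd x" using assms by (auto dest!: dvd_imp_le)
    then show ?thesis using True conn_nat[of S n x] D(3)[of "int x"] assms d by auto
  qed (use assms in auto)
  then have "S = {k * d | k. k \<in> {1..m div 2}}"
    unfolding multiples_upto_half[OF d(2)] m[symmetric] by blast
  then show "\<exists>d\<ge>1. \<exists>m. n = d * m \<and> circulant n S = circulant n {k * d | k. k \<in> {1..m div 2}}"
    using d m by blast
next
  assume "\<exists>d\<ge>1. \<exists>m. n = d * m \<and> circulant n S = circulant n {k * d | k. k \<in> {1..m div 2}}"
  then obtain d m where "d \<ge> 1" "n = d * m"
    "circulant n S = circulant n {k * d | k. k \<in> {1..m div 2}}" by blast
  \<comment> \<open>The value \<open>m = 0\<close> would force \<open>n = 0\<close>.\<close>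
  then show "chordal (circulant n S)"
    using chordal_circulant_multiples[of d m] assms by (cases "m = 0") auto
qed

end
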